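(* Let $\mathbb{B}$ be a poset Boolean algebra and let $\kappa$ be a regular uncountable cardinal such that $|\mathbb{B}| \geq \kappa$. Then for every generating set $G \subseteq \mathbb{B}$ there exists an ultrafilter $p \in \mathrm{Ult}(\mathbb{B})$ such that $|G \cap p| \geq \kappa$, and thus $\mathbb{B}$ is not $\kappa$-Corson. In particular, if $|\mathbb{B}|$ is a regular uncountable cardinal then for every generating set $G \subseteq \mathbb{B}$ there exists an ultrafilter $p \in \mathrm{Ult}(\mathbb{B})$ such that $|G \cap p| = |\mathbb{B}|$, that is, $\mathbb{B}$ is not $|\mathbb{B}|$-Corson.
   Context: For a poset $P$, let $\mathrm{Fr}(P)$ be the free Boolean algebra over the set $P$, with canonical embedding $x : P \to \mathrm{Fr}(P)$, and let $I_P$ be the ideal of $\mathrm{Fr}(P)$ generated by $\{x(p) \cdot (-x(q)) : p \leq q \text{ in } P\}$. The poset algebra is $\mathbb{B}(P) = \mathrm{Fr}(P)/I_P$. A poset Boolean algebra is a Boolean algebra (isomorphic to one) of the form $\mathbb{B}(P)$ for some poset $P$. $\mathrm{Ult}(\mathbb{B})$ is the set of ultrafilters of $\mathbb{B}$. A Boolean algebra $\mathbb{B}$ is $\kappa$-Corson if there is a set $G \subseteq \mathbb{B}$ generating $\mathbb{B}$ as a Boolean algebra such that $|G \cap p| < \kappa$ for every $p \in \mathrm{Ult}(\mathbb{B})$. *)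

theory Defs
  imports Main "HOL.Hull"
begin

unbundle cardinal_syntax

section \<open>Boolean algebras\<close>

definition ba_subalgebra :: "'a::boolean_algebra set \<Rightarrow> bool" where
  "ba_subalgebra S \<longleftrightarrow> bot \<in> S \<and> top \<in> S \<and> (\<forall>a\<in>S. - a \<in> S) \<and>
     (\<forall>a\<in>S. \<forall>b\<in>S. inf a b \<in> S \<and> sup a b \<in> S)"

definition ba_generates :: "'a::boolean_algebra set \<Rightarrow> bool" where
  "ba_generates G \<longleftrightarrow> ba_subalgebra hull G = UNIV"

definition ba_ideal :: "'a::boolean_algebra set \<Rightarrow> bool" where
  "ba_ideal I \<longleftrightarrow> bot \<in> I \<and> (\<forall>a\<in>I. \<forall>b. b \<le> a \<longrightarrow> b \<in> I) \<and> (\<forall>a\<in>I. \<forall>b\<in>I. sup a b \<in> I)"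

definition ba_filter :: "'a::boolean_algebra set \<Rightarrow> bool" where
  "ba_filter F \<longleftrightarrow> top \<in> F \<and> (\<forall>a\<in>F. \<forall>b. a \<le> b \<longrightarrow> b \<in> F) \<and> (\<forall>a\<in>F. \<forall>b\<in>F. inf a b \<in> F)"

definition ba_ultrafilter :: "'a::boolean_algebra set \<Rightarrow> bool" where
  "ba_ultrafilter F \<longleftrightarrow> ba_filter F \<and> bot \<notin> F \<and>
     (\<forall>F'. ba_filter F' \<and> bot \<notin> F' \<and> F \<subseteq> F' \<longrightarrow> F' = F)"

definition ba_hom :: "('a::boolean_algebra \<Rightarrow> 'b::boolean_algebra) \<Rightarrow> bool" where
  "ba_hom h \<longleftrightarrow> h bot = bot \<and> h top = top \<and> (\<forall>a. h (- a) = - h a) \<and>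
     (\<forall>a b. h (inf a b) = inf (h a) (h b) \<and> h (sup a b) = sup (h a) (h b))"

definition ba_iso :: "('a::boolean_algebra \<Rightarrow> 'b::boolean_algebra) \<Rightarrow> bool" where
  "ba_iso h \<longleftrightarrow> ba_hom h \<and> bij h"


section \<open>Free Boolean algebras\<close>

text \<open>The free Boolean algebra over \<open>'p\<close> is the algebra of Boolean terms with variables in \<open>'p\<close>,
  modulo provable equality from the axioms of Boolean algebras.\<close>

datatype 'p bterm = BVar 'p | BBot | BTop | BNeg "'p bterm"
  | BInf "'p bterm" "'p bterm" | BSup "'p bterm" "'p bterm"

inductive beq :: "'p bterm \<Rightarrow> 'p bterm \<Rightarrow> bool" where
  beq_refl: "beq s s"
| beq_sym: "beq s t \<Longrightarrow> beq t s"
| beq_trans: "beq s t \<Longrightarrow> beq t u \<Longrightarrow> beq s u"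
| beq_neg: "beq s t \<Longrightarrow> beq (BNeg s) (BNeg t)"
| beq_inf: "beq s t \<Longrightarrow> beq s' t' \<Longrightarrow> beq (BInf s s') (BInf t t')"
| beq_sup: "beq s t \<Longrightarrow> beq s' t' \<Longrightarrow> beq (BSup s s') (BSup t t')"
| inf_commute: "beq (BInf s t) (BInf t s)"
| sup_commute: "beq (BSup s t) (BSup t s)"
| inf_assoc: "beq (BInf (BInf s t) u) (BInf s (BInf t u))"
| sup_assoc: "beq (BSup (BSup s t) u) (BSup s (BSup t u))"
| inf_absorb: "beq (BInf s (BSup s t)) s"
| sup_absorb: "beq (BSup s (BInf s t)) s"
| sup_inf_distrib: "beq (BSup s (BInf t u)) (BInf (BSup s t) (BSup s u))"
| inf_compl: "beq (BInf s (BNeg s)) BBot"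
| sup_compl: "beq (BSup s (BNeg s)) BTop"
| inf_top: "beq (BInf s BTop) s"
| sup_bot: "beq (BSup s BBot) s"

lemma equivp_beq: "equivp (beq :: 'p bterm \<Rightarrow> _)"
  by (rule equivpI) (auto intro!: reflpI sympI transpI intro: beq_refl beq_sym beq_trans)

quotient_type 'p free_ba = "'p bterm" / beq
  by (rule equivp_beq)

lift_definition free_gen :: "'p \<Rightarrow> 'p free_ba" is BVar .

instantiation free_ba :: (type) boolean_algebra
begin

lift_definition bot_free_ba :: "'a free_ba" is BBot .
lift_definition top_free_ba :: "'a free_ba" is BTop .
lift_definition uminus_free_ba :: "'a free_ba \<Rightarrow> 'a free_ba" is BNeg by (rule beq_neg)
lift_definition inf_free_ba :: "'a free_ba \<Rightarrow> 'a free_ba \<Rightarrow> 'a free_ba" is BInf by (rule beq_inf)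
lift_definition sup_free_ba :: "'a free_ba \<Rightarrow> 'a free_ba \<Rightarrow> 'a free_ba" is BSup by (rule beq_sup)
definition minus_free_ba :: "'a free_ba \<Rightarrow> 'a free_ba \<Rightarrow> 'a free_ba" where
  "minus_free_ba a b = inf a (- b)"
definition less_eq_free_ba :: "'a free_ba \<Rightarrow> 'a free_ba \<Rightarrow> bool" where
  "less_eq_free_ba a b \<longleftrightarrow> inf a b = a"
definition less_free_ba :: "'a free_ba \<Rightarrow> 'a free_ba \<Rightarrow> bool" where
  "less_free_ba a b \<longleftrightarrow> a \<le> b \<and> \<not> b \<le> a"

instance
proof
  fix a b c :: "'a free_ba"
  have ic: "inf x y = inf y x" for x y :: "'a free_ba" by transfer (rule inf_commute)
  have sc: "sup x y = sup y x" for x y :: "'a free_ba" by transfer (rule sup_commute)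
  have ia: "inf (inf x y) z = inf x (inf y z)" for x y z :: "'a free_ba" by transfer (rule inf_assoc)
  have sa: "sup (sup x y) z = sup x (sup y z)" for x y z :: "'a free_ba" by transfer (rule sup_assoc)
  have ib: "inf x (sup x y) = x" for x y :: "'a free_ba" by transfer (rule inf_absorb)
  have sb: "sup x (inf x y) = x" for x y :: "'a free_ba" by transfer (rule sup_absorb)
  have it: "inf x top = x" for x :: "'a free_ba" by transfer (rule inf_top)
  have st: "sup x bot = x" for x :: "'a free_ba" by transfer (rule sup_bot)
  have ii: "inf x x = x" for x :: "'a free_ba" by (metis ib sb)
  have le_sup: "x \<le> y \<longleftrightarrow> sup x y = y" for x y :: "'a free_ba"
    unfolding less_eq_free_ba_def by (metis ib ic sb sc)
  show "(a < b) = (a \<le> b \<and> \<not> b \<le> a)" by (rule less_free_ba_def)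
  show "a \<le> a" by (simp add: less_eq_free_ba_def ii)
  show "a \<le> b \<Longrightarrow> b \<le> c \<Longrightarrow> a \<le> c" unfolding less_eq_free_ba_def by (metis ia)
  show "a \<le> b \<Longrightarrow> b \<le> a \<Longrightarrow> a = b" unfolding less_eq_free_ba_def by (metis ic)
  show "inf a b \<le> a" unfolding less_eq_free_ba_def by (metis ia ic ii)
  show "inf a b \<le> b" unfolding less_eq_free_ba_def by (metis ia ii)
  show "a \<le> b \<Longrightarrow> a \<le> c \<Longrightarrow> a \<le> inf b c" unfolding less_eq_free_ba_def by (metis ia)
  show "a \<le> sup a b" unfolding less_eq_free_ba_def by (rule ib)
  show "b \<le> sup a b" unfolding less_eq_free_ba_def by (metis ib sc)
  show "b \<le> a \<Longrightarrow> c \<le> a \<Longrightarrow> sup b c \<le> a" unfolding le_sup by (metis sa)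
  show "bot \<le> a" unfolding le_sup by (metis sc st)
  show "a \<le> top" unfolding less_eq_free_ba_def by (rule it)
  show "sup a (inf b c) = inf (sup a b) (sup a c)" by transfer (rule sup_inf_distrib)
  show "inf a (- a) = bot" by transfer (rule inf_compl)
  show "sup a (- a) = top" by transfer (rule sup_compl)
  show "a - b = inf a (- b)" by (rule minus_free_ba_def)
qed

end

primrec bterm_eval :: "('p \<Rightarrow> 'b::boolean_algebra) \<Rightarrow> 'p bterm \<Rightarrow> 'b" where
  "bterm_eval f (BVar p) = f p"
| "bterm_eval f BBot = bot"
| "bterm_eval f BTop = top"
| "bterm_eval f (BNeg s) = - bterm_eval f s"
| "bterm_eval f (BInf s t) = inf (bterm_eval f s) (bterm_eval f t)"
| "bterm_eval f (BSup s t) = sup (bterm_eval f s) (bterm_eval f t)"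

lemma bterm_eval_cong: "beq s t \<Longrightarrow> bterm_eval f s = bterm_eval f t"
  by (induction rule: beq.induct) (simp_all add: ac_simps sup_inf_distrib1)

lift_definition free_eval :: "('p \<Rightarrow> 'b::boolean_algebra) \<Rightarrow> 'p free_ba \<Rightarrow> 'b" is bterm_eval
  by (rule bterm_eval_cong)

theorem free_ba_universal:
  fixes f :: "'p \<Rightarrow> 'b::boolean_algebra"
  shows "\<exists>!h. ba_hom h \<and> (\<forall>p. h (free_gen p) = f p)"
proof
  show "ba_hom (free_eval f) \<and> (\<forall>p. free_eval f (free_gen p) = f p)"
    unfolding ba_hom_def by (intro conjI allI; transfer) simp_all
next
  fix h :: "'p free_ba \<Rightarrow> 'b"
  assume h: "ba_hom h \<and> (\<forall>p. h (free_gen p) = f p)"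
  have "h (abs_free_ba s) = bterm_eval f s" for s
  proof (induction s)
    case (BVar p) then show ?case using h by (metis bterm_eval.simps(1) free_gen.abs_eq)
  next
    case BBot then show ?case using h by (metis ba_hom_def bterm_eval.simps(2) bot_free_ba.abs_eq)
  next
    case BTop then show ?case using h by (metis ba_hom_def bterm_eval.simps(3) top_free_ba.abs_eq)
  next
    case (BNeg s) then show ?case using h by (metis ba_hom_def bterm_eval.simps(4) uminus_free_ba.abs_eq)
  next
    case (BInf s t) then show ?case using h by (metis ba_hom_def bterm_eval.simps(5) inf_free_ba.abs_eq)
  next
    case (BSup s t) then show ?case using h by (metis ba_hom_def bterm_eval.simps(6) sup_free_ba.abs_eq)
  qed
  then have "h (abs_free_ba s) = free_eval f (abs_free_ba s)" for s
    by (simp add: free_eval.abs_eq)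
  then show "h = free_eval f"
    by (metis ext Quotient_free_ba Quotient_abs_rep)
qed


section \<open>Poset algebras\<close>

definition poset_ideal :: "'p::order free_ba set" where
  "poset_ideal = ba_ideal hull {inf (free_gen p) (- free_gen q) | p q. p \<le> q}"

lemma ba_ideal_hull: "ba_ideal (ba_ideal hull S)"
  by (rule hull_in) (auto simp: ba_ideal_def)

definition poset_eq :: "'p::order free_ba \<Rightarrow> 'p free_ba \<Rightarrow> bool" where
  "poset_eq a b \<longleftrightarrow> sup (inf a (- b)) (inf b (- a)) \<in> poset_ideal"

lemma ba_ideal_poset_ideal: "ba_ideal poset_ideal"
  unfolding poset_ideal_def by (rule ba_ideal_hull)

lemma poset_ideal_bot: "bot \<in> poset_ideal"
  and poset_ideal_down: "a \<in> poset_ideal \<Longrightarrow> b \<le> a \<Longrightarrow> b \<in> poset_ideal"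
  and poset_ideal_sup: "a \<in> poset_ideal \<Longrightarrow> b \<in> poset_ideal \<Longrightarrow> sup a b \<in> poset_ideal"
  using ba_ideal_poset_ideal unfolding ba_ideal_def by blast+

lemma poset_eq_iff: "poset_eq a b \<longleftrightarrow> inf a (- b) \<in> poset_ideal \<and> inf b (- a) \<in> poset_ideal"
  unfolding poset_eq_def
  by (meson poset_ideal_down poset_ideal_sup sup_ge1 sup_ge2)

lemma poset_ideal_trans:
  assumes "inf a (- b) \<in> poset_ideal" "inf b (- c) \<in> poset_ideal"
  shows "inf a (- c) \<in> poset_ideal"
proof (rule poset_ideal_down[OF poset_ideal_sup[OF assms]])
  have "inf a (- c) = sup (inf (inf a (- c)) b) (inf (inf a (- c)) (- b))"
    by (simp flip: inf_sup_distrib1)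
  also have "\<dots> \<le> sup (inf b (- c)) (inf a (- b))"
    by (intro sup_mono) (auto intro: le_infI1 le_infI2)
  finally show "inf a (- c) \<le> sup (inf a (- b)) (inf b (- c))"
    by (simp add: sup.commute)
qed

lemma poset_ideal_inf:
  assumes "inf a (- b) \<in> poset_ideal" "inf c (- d) \<in> poset_ideal"
  shows "inf (inf a c) (- inf b d) \<in> poset_ideal"
proof (rule poset_ideal_down[OF poset_ideal_sup[OF assms]])
  show "inf (inf a c) (- inf b d) \<le> sup (inf a (- b)) (inf c (- d))"
    unfolding compl_inf inf_sup_distrib1
    by (intro sup_mono) (auto intro: le_infI1 le_infI2)
qed

lemma poset_ideal_sup2:
  assumes "inf a (- b) \<in> poset_ideal" "inf c (- d) \<in> poset_ideal"
  shows "inf (sup a c) (- sup b d) \<in> poset_ideal"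
proof (rule poset_ideal_down[OF poset_ideal_sup[OF assms]])
  show "inf (sup a c) (- sup b d) \<le> sup (inf a (- b)) (inf c (- d))"
    unfolding compl_sup inf_sup_distrib2
    by (intro sup_mono) (auto intro: le_infI1 le_infI2)
qed

text \<open>The quotient of the free Boolean algebra over the poset \<open>'p\<close> by \<open>poset_ideal\<close>.\<close>

quotient_type (overloaded) 'p poset_algebra = "'p::order free_ba" / poset_eq
proof (rule equivpI)
  show "reflp poset_eq" by (rule reflpI) (simp add: poset_eq_iff poset_ideal_bot)
  show "symp poset_eq" by (rule sympI) (simp add: poset_eq_iff)
  show "transp poset_eq" by (rule transpI) (auto simp: poset_eq_iff intro: poset_ideal_trans)
qed

instantiation poset_algebra :: (order) boolean_algebra
begin

lift_definition bot_poset_algebra :: "'a poset_algebra" is bot .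
lift_definition top_poset_algebra :: "'a poset_algebra" is top .
lift_definition uminus_poset_algebra :: "'a poset_algebra \<Rightarrow> 'a poset_algebra" is uminus
  by (simp add: poset_eq_iff inf.commute)
lift_definition inf_poset_algebra :: "'a poset_algebra \<Rightarrow> 'a poset_algebra \<Rightarrow> 'a poset_algebra"
  is inf unfolding poset_eq_iff by (meson poset_ideal_inf)
lift_definition sup_poset_algebra :: "'a poset_algebra \<Rightarrow> 'a poset_algebra \<Rightarrow> 'a poset_algebra"
  is sup unfolding poset_eq_iff by (meson poset_ideal_sup2)
definition minus_poset_algebra :: "'a poset_algebra \<Rightarrow> 'a poset_algebra \<Rightarrow> 'a poset_algebra" where
  "minus_poset_algebra a b = inf a (- b)"
definition less_eq_poset_algebra :: "'a poset_algebra \<Rightarrow> 'a poset_algebra \<Rightarrow> bool" where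
  "less_eq_poset_algebra a b \<longleftrightarrow> inf a b = a"
definition less_poset_algebra :: "'a poset_algebra \<Rightarrow> 'a poset_algebra \<Rightarrow> bool" where
  "less_poset_algebra a b \<longleftrightarrow> a \<le> b \<and> \<not> b \<le> a"

instance
proof
  fix a b c :: "'a poset_algebra"
  have eqI: "poset_eq x y" if "x = y" for x y :: "'a free_ba"
    using that by (simp add: poset_eq_iff poset_ideal_bot)
  have ic: "inf x y = inf y x" for x y :: "'a poset_algebra"
    by transfer (rule eqI, rule inf.commute)
  have sc: "sup x y = sup y x" for x y :: "'a poset_algebra"
    by transfer (rule eqI, rule sup.commute)
  have ia: "inf (inf x y) z = inf x (inf y z)" for x y z :: "'a poset_algebra"
    by transfer (rule eqI, rule inf.assoc)
  have sa: "sup (sup x y) z = sup x (sup y z)" for x y z :: "'a poset_algebra"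
    by transfer (rule eqI, rule sup.assoc)
  have ib: "inf x (sup x y) = x" for x y :: "'a poset_algebra" by transfer (rule eqI, simp)
  have sb: "sup x (inf x y) = x" for x y :: "'a poset_algebra" by transfer (rule eqI, simp)
  have it: "inf x top = x" for x :: "'a poset_algebra" by transfer (rule eqI, simp)
  have st: "sup x bot = x" for x :: "'a poset_algebra" by transfer (rule eqI, simp)
  have ii: "inf x x = x" for x :: "'a poset_algebra" by (metis ib sb)
  have le_sup: "x \<le> y \<longleftrightarrow> sup x y = y" for x y :: "'a poset_algebra"
    unfolding less_eq_poset_algebra_def by (metis ib ic sb sc)
  show "(a < b) = (a \<le> b \<and> \<not> b \<le> a)" by (rule less_poset_algebra_def)
  show "a \<le> a" by (simp add: less_eq_poset_algebra_def ii)
  show "a \<le> b \<Longrightarrow> b \<le> c \<Longrightarrow> a \<le> c" unfolding less_eq_poset_algebra_def by (metis ia)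
  show "a \<le> b \<Longrightarrow> b \<le> a \<Longrightarrow> a = b" unfolding less_eq_poset_algebra_def by (metis ic)
  show "inf a b \<le> a" unfolding less_eq_poset_algebra_def by (metis ia ic ii)
  show "inf a b \<le> b" unfolding less_eq_poset_algebra_def by (metis ia ii)
  show "a \<le> b \<Longrightarrow> a \<le> c \<Longrightarrow> a \<le> inf b c" unfolding less_eq_poset_algebra_def by (metis ia)
  show "a \<le> sup a b" unfolding less_eq_poset_algebra_def by (rule ib)
  show "b \<le> sup a b" unfolding less_eq_poset_algebra_def by (metis ib sc)
  show "b \<le> a \<Longrightarrow> c \<le> a \<Longrightarrow> sup b c \<le> a" unfolding le_sup by (metis sa)
  show "bot \<le> a" unfolding le_sup by (metis sc st)
  show "a \<le> top" unfolding less_eq_poset_algebra_def by (rule it)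
  show "sup a (inf b c) = inf (sup a b) (sup a c)"
    by transfer (rule eqI, rule sup_inf_distrib1)
  show "inf a (- a) = bot" by transfer (rule eqI, simp)
  show "sup a (- a) = top" by transfer (rule eqI, simp)
  show "a - b = inf a (- b)" by (rule minus_poset_algebra_def)
qed

end

text \<open>Posets are types of class \<open>order\<close>.  As types are nonempty, the empty poset is not covered;
  its poset algebra is the two-element algebra.\<close>

definition poset_boolean_algebra :: "'p::order itself \<Rightarrow> 'b::boolean_algebra itself \<Rightarrow> bool" where
  "poset_boolean_algebra _ _ \<longleftrightarrow> (\<exists>h :: 'p poset_algebra \<Rightarrow> 'b. ba_iso h)"


section \<open>Cardinals and Corson algebras\<close>

definition regular_uncountable :: "'k rel \<Rightarrow> bool" where
  "regular_uncountable \<kappa> \<longleftrightarrow> Card_order \<kappa> \<and> natLeq <o \<kappa> \<and> regularCard \<kappa>"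

definition corson :: "'k rel \<Rightarrow> 'b::boolean_algebra itself \<Rightarrow> bool" where
  "corson \<kappa> _ \<longleftrightarrow> (\<exists>G :: 'b set. ba_generates G \<and> (\<forall>p. ba_ultrafilter p \<longrightarrow> |G \<inter> p| <o \<kappa>))"

end

(*
  Ultrafilters of B(P) correspond to up-sets of P.  Suppose every ultrafilter meets G in fewer
  than kappa elements.  A closing-off argument of length omega yields A \<subseteq> P with |A| < kappa such
  that, for all finite F \<subseteq> A, every g in G that holds at the up-set generated by F, or at the
  complement of the down-set generated by F, has its (finite) support inside A.  By continuity the
  same is true with F replaced by an arbitrary subset of A.  As |P| \<ge> kappa there is p in P - A; put
  V = {a \<in> A. p \<le> a}.  The up-set generated by V and the complement of the down-set generated by
  A - V have the same trace V on A, hence lie in the same members of G, hence are equal because G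
  generates.  But p belongs to the second and not to the first.
*)
theory Submission
  imports Defs
begin

section \<open>Regular uncountable cardinals\<close>

lemma regular_uncountable_UNION:
  assumes "regular_uncountable \<kappa>" "|I| <o \<kappa>" "\<And>i. i \<in> I \<Longrightarrow> |A i| <o \<kappa>"
  shows "|\<Union>i\<in>I. A i| <o \<kappa>"
proof (rule card_of_UNION_ordLess_infinite_Field_regularCard)
  have less: "natLeq <o |Field \<kappa>|"
    using assms(1) unfolding regular_uncountable_def
    by (elim conjE) (rule ordLess_ordIso_trans[OF _ ordIso_symmetric[OF card_of_Field_ordIso]])
  have "infinite (Field \<kappa>)"
  proof
    assume "finite (Field \<kappa>)"
    then have "|Field \<kappa>| <o natLeq" by (simp only: finite_iff_ordLess_natLeq)
    from ordLess_transitive[OF this less] show False by (simp add: ordLess_irreflexive)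
  qed
  then show "Cinfinite \<kappa>"
    using assms(1) by (simp add: regular_uncountable_def cinfinite_def)
  show "regularCard \<kappa>" using assms(1) by (simp add: regular_uncountable_def)
qed (use assms in auto)

lemma regular_uncountable_countable:
  assumes "regular_uncountable \<kappa>"
  shows "|UNIV :: nat set| <o \<kappa>"
  using assms unfolding regular_uncountable_def
  by (elim conjE) (rule ordIso_ordLess_trans[OF card_of_nat])

lemma regular_uncountable_finite:
  assumes "regular_uncountable \<kappa>" "finite A"
  shows "|A| <o \<kappa>"
  using assms unfolding regular_uncountable_def finite_iff_ordLess_natLeq
  by (elim conjE) (rule ordLess_transitive)

lemma regular_uncountable_Un:
  assumes "regular_uncountable \<kappa>" "|A| <o \<kappa>" "|B| <o \<kappa>"
  shows "|A \<union> B| <o \<kappa>"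
proof -
  have "|\<Union>b\<in>UNIV::bool set. if b then A else B| <o \<kappa>"
    by (rule regular_uncountable_UNION[OF assms(1)])
      (use assms regular_uncountable_finite[of \<kappa> "UNIV :: bool set"] in auto)
  then show ?thesis by (simp add: UNIV_bool Un_commute)
qed

lemma card_of_image_ordLess: "|A| <o \<kappa> \<Longrightarrow> |f ` A| <o \<kappa>"
  by (rule ordLeq_ordLess_trans[OF card_of_image])

text \<open>Iterate \<omega> times. Regularity keeps each stage below \<kappa>, and uncountability
  keeps the union of the countably many stages below it. The stages increase, so two elements share
  a stage and the next one absorbs their \<open>D\<close>. A set-valued \<open>D\<close> allows
  fewer than \<kappa> new elements per pair.\<close>

lemma binary_closure_ordLess:
  assumes \<kappa>: "regular_uncountable \<kappa>" and A: "|A| <o \<kappa>" and D: "\<And>a b. |D a b| <o \<kappa>"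
  obtains C where "A \<subseteq> C" "|C| <o \<kappa>" "\<And>a b. a \<in> C \<Longrightarrow> b \<in> C \<Longrightarrow> D a b \<subseteq> C"
proof -
  define S where "S = rec_nat A (\<lambda>_ T. T \<union> (\<Union>a\<in>T. \<Union>b\<in>T. D a b))"
  have S_Suc: "S (Suc n) = S n \<union> (\<Union>a\<in>S n. \<Union>b\<in>S n. D a b)" for n
    by (simp add: S_def)
  have S_less: "|S n| <o \<kappa>" for n
  proof (induction n)
    case 0
    then show ?case using A by (simp add: S_def)
  next
    case (Suc n)
    then show ?case
      unfolding S_Suc
      by (intro regular_uncountable_Un[OF \<kappa>] regular_uncountable_UNION[OF \<kappa>] D)
  qed
  have "mono S" by (simp add: mono_iff_le_Suc S_Suc)
  show ?thesis
  proof
    have "S 0 = A" by (simp add: S_def)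
    then show "A \<subseteq> (\<Union>n. S n)" by blast
    show "|\<Union>n. S n| <o \<kappa>"
      by (intro regular_uncountable_UNION[OF \<kappa>] regular_uncountable_countable[OF \<kappa>] S_less)
    fix a b assume "a \<in> (\<Union>n. S n)" "b \<in> (\<Union>n. S n)"
    then obtain m n where "a \<in> S m" "b \<in> S n" by blast
    then have "a \<in> S (max m n)" "b \<in> S (max m n)"
      using monoD[OF \<open>mono S\<close>] by (meson max.cobounded1 max.cobounded2 subsetD)+
    then have "D a b \<subseteq> S (Suc (max m n))" unfolding S_Suc by blast
    then show "D a b \<subseteq> (\<Union>n. S n)" by blast
  qed
qed

text \<open>Terms are the closure of variables and constants under a \<open>D\<close> with finite
  values, so no arithmetic of infinite cardinals is needed and a finite \<open>'p\<close> is no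
  special case.\<close>

lemma card_of_bterm_ordLess:
  assumes \<kappa>: "regular_uncountable \<kappa>" and P: "|UNIV :: 'p set| <o \<kappa>"
  shows "|UNIV :: 'p bterm set| <o \<kappa>"
proof -
  have "|range (BVar :: 'p \<Rightarrow> _) \<union> {BBot, BTop}| <o \<kappa>"
    by (intro regular_uncountable_Un[OF \<kappa>] card_of_image_ordLess[OF P]
        regular_uncountable_finite[OF \<kappa>]) simp
  moreover have "|{BNeg s, BInf s t, BSup s t}| <o \<kappa>" for s t :: "'p bterm"
    by (intro regular_uncountable_finite[OF \<kappa>]) simp
  ultimately obtain C :: "'p bterm set" where
    C: "range BVar \<union> {BBot, BTop} \<subseteq> C" "|C| <o \<kappa>"
       "\<And>s t. s \<in> C \<Longrightarrow> t \<in> C \<Longrightarrow> {BNeg s, BInf s t, BSup s t} \<subseteq> C"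
    using binary_closure_ordLess[OF \<kappa>, of _ "\<lambda>s t. {BNeg s, BInf s t, BSup s t}"] by metis
  have "t \<in> C" for t
    by (induction t) (use C(1,3) in auto)
  then have "C = UNIV" by blast
  with C(2) show ?thesis by simp
qed

section \<open>Ultrafilters from up-sets\<close>

text \<open>Here \<open>bool\<close> serves as the two-element algebra. Maximality: a new element b
  of a larger filter would join - b, which is already there, and their meet is
  \<open>bot\<close>.\<close>

lemma ba_ultrafilter_hom:
  fixes e :: "'b::boolean_algebra \<Rightarrow> bool"
  assumes "ba_hom e"
  shows "ba_ultrafilter {b. e b}"
proof -
  have e: "\<not> e bot" "e top" "e (- a) \<longleftrightarrow> \<not> e a" "e (inf a b) \<longleftrightarrow> e a \<and> e b"
    for a b using assms by (auto simp: ba_hom_def)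
  have "e b" if "e a" "a \<le> b" for a b
    using e(4)[of a b] that by (simp add: inf_absorb1)
  then have "ba_filter {b. e b}"
    by (auto simp: ba_filter_def e)
  moreover have "F' = {b. e b}" if F': "ba_filter F'" "bot \<notin> F'" "{b. e b} \<subseteq> F'" for F'
  proof -
    have "e b" if "b \<in> F'" for b
    proof (rule ccontr)
      assume "\<not> e b"
      then have "- b \<in> F'" using e F'(3) by blast
      with F'(1) that have "inf b (- b) \<in> F'" unfolding ba_filter_def by blast
      then show False using F'(2) by simp
    qed
    then show ?thesis using F'(3) by blast
  qed
  ultimately show ?thesis using e by (simp add: ba_ultrafilter_def)
qed

definition upset :: "'p::order set \<Rightarrow> bool" where
  "upset U \<longleftrightarrow> (\<forall>p q. p \<in> U \<longrightarrow> p \<le> q \<longrightarrow> q \<in> U)"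

lemma ba_hom_free_eval: "ba_hom (free_eval f)"
  unfolding ba_hom_def by (intro conjI allI; transfer) simp_all

text \<open>The elements evaluated to \<open>False\<close> form an ideal, and upward closure of U
  puts the generators of \<open>poset_ideal\<close> into it. Evaluation at an up-set therefore
  factors through the quotient.\<close>

lemma free_eval_poset_ideal:
  assumes "upset U" "a \<in> poset_ideal"
  shows "\<not> free_eval (\<lambda>p. p \<in> U) a"
proof -
  let ?e = "free_eval (\<lambda>p. p \<in> U)"
  have e: "\<not> ?e bot" "?e (- a) \<longleftrightarrow> \<not> ?e a" "?e (inf a b) \<longleftrightarrow> ?e a \<and> ?e b"
    "?e (sup a b) \<longleftrightarrow> ?e a \<or> ?e b" for a b
    using ba_hom_free_eval[of "\<lambda>p. p \<in> U"] by (auto simp: ba_hom_def)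
  have gen: "?e (free_gen p) \<longleftrightarrow> p \<in> U" for p by transfer simp
  have "poset_ideal \<subseteq> {a. \<not> ?e a}"
    unfolding poset_ideal_def
  proof (rule hull_minimal)
    show "{inf (free_gen p) (- free_gen q) | p q. p \<le> q} \<subseteq> {a. \<not> ?e a}"
      using assms(1) by (auto simp: e gen upset_def)
    have "\<not> ?e b" if "\<not> ?e a" "b \<le> a" for a b
      using e(3)[of b a] that by (simp add: inf_absorb1)
    then show "ba_ideal {a. \<not> ?e a}"
      by (auto simp: ba_ideal_def e)
  qed
  with assms(2) show ?thesis by blast
qed

text \<open>A chosen representative is evaluated because U is arbitrary here, whereas independence
  of the choice holds for up-sets only.\<close>

definition upset_eval :: "'p::order set \<Rightarrow> 'p poset_algebra \<Rightarrow> bool" where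
  "upset_eval U b = free_eval (\<lambda>p. p \<in> U) (rep_poset_algebra b)"

lemma upset_eval_abs:
  assumes "upset U"
  shows "upset_eval U (abs_poset_algebra a) \<longleftrightarrow> free_eval (\<lambda>p. p \<in> U) a"
proof -
  let ?r = "rep_poset_algebra (abs_poset_algebra a)"
  have "poset_eq ?r a"
    by (rule Quotient3_rep_abs[OF Quotient3_poset_algebra]) (simp add: poset_eq_iff poset_ideal_bot)
  then have "inf ?r (- a) \<in> poset_ideal" "inf a (- ?r) \<in> poset_ideal"
    by (auto simp: poset_eq_iff)
  from this[THEN free_eval_poset_ideal[OF assms]] show ?thesis
    using ba_hom_free_eval[of "\<lambda>p. p \<in> U"] unfolding upset_eval_def ba_hom_def by auto
qed

lemma ba_hom_upset_eval:
  assumes "upset U"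
  shows "ba_hom (upset_eval U)"
proof -
  let ?e = "free_eval (\<lambda>p. p \<in> U)"
  have e: "\<not> ?e bot" "?e top" "?e (- a) \<longleftrightarrow> \<not> ?e a" "?e (inf a b) \<longleftrightarrow> ?e a \<and> ?e b"
    "?e (sup a b) \<longleftrightarrow> ?e a \<or> ?e b" for a b
    using ba_hom_free_eval[of "\<lambda>p. p \<in> U"] by (auto simp: ba_hom_def)
  have ops: "upset_eval U (inf a b) \<longleftrightarrow> upset_eval U a \<and> upset_eval U b"
    "upset_eval U (sup a b) \<longleftrightarrow> upset_eval U a \<or> upset_eval U b"
    "upset_eval U (- a) \<longleftrightarrow> \<not> upset_eval U a" for a b
  proof -
    obtain a' b' where "a = abs_poset_algebra a'" "b = abs_poset_algebra b'"
      using Quotient3_abs_rep[OF Quotient3_poset_algebra] by metis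
    then show "upset_eval U (inf a b) \<longleftrightarrow> upset_eval U a \<and> upset_eval U b"
      "upset_eval U (sup a b) \<longleftrightarrow> upset_eval U a \<or> upset_eval U b"
      "upset_eval U (- a) \<longleftrightarrow> \<not> upset_eval U a"
      by (simp_all add: upset_eval_abs[OF assms] e inf_poset_algebra.abs_eq
          sup_poset_algebra.abs_eq uminus_poset_algebra.abs_eq)
  qed
  have "\<not> upset_eval U bot" "upset_eval U top"
    by (simp_all add: upset_eval_abs[OF assms] e bot_poset_algebra.abs_eq top_poset_algebra.abs_eq)
  with ops show ?thesis by (simp add: ba_hom_def)
qed

section \<open>Finite supports, transport along the isomorphism, and generators\<close>

lemma bterm_eval_cong_set:
  "(\<And>p. p \<in> set_bterm t \<Longrightarrow> f p = g p) \<Longrightarrow> bterm_eval f t = bterm_eval g t"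
  by (induction t) auto

lemma finite_set_bterm: "finite (set_bterm t)"
  by (induction t) auto

text \<open>Hides both quotients and the isomorphism: from here on, elements are named by terms
  through \<open>i\<close>, and up-sets act by evaluating those terms.\<close>

lemma poset_boolean_algebra_terms:
  assumes "poset_boolean_algebra TYPE('p::order) TYPE('b::boolean_algebra)"
  obtains i :: "'p::order bterm \<Rightarrow> 'b::boolean_algebra" and e :: "'p set \<Rightarrow> 'b \<Rightarrow> bool"
  where "surj i" "\<And>U. upset U \<Longrightarrow> ba_hom (e U)"
    "\<And>U t. upset U \<Longrightarrow> e U (i t) \<longleftrightarrow> bterm_eval (\<lambda>p. p \<in> U) t"
proof -
  obtain h :: "'p poset_algebra \<Rightarrow> 'b" where h: "ba_hom h" "bij h"
    using assms by (auto simp: poset_boolean_algebra_def ba_iso_def)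
  then have inv: "inv h (h a) = a" "h (inv h b) = b" for a b
    by (simp_all add: bij_is_inj bij_is_surj surj_f_inv_f)
  have inv_hom: "inv h bot = bot" "inv h top = top" "inv h (- a) = - inv h a"
    "inv h (inf a b) = inf (inv h a) (inv h b)" "inv h (sup a b) = sup (inv h a) (inv h b)" for a b
    using h(1) inv unfolding ba_hom_def by metis+
  show ?thesis
  proof (rule that[of "\<lambda>t. h (abs_poset_algebra (abs_free_ba t))" "\<lambda>U b. upset_eval U (inv h b)"])
    show "surj (\<lambda>t. h (abs_poset_algebra (abs_free_ba t)))"
    proof (rule surjI)
      show "h (abs_poset_algebra (abs_free_ba (rep_free_ba (rep_poset_algebra (inv h b))))) = b" for b
        by (simp add: Quotient3_abs_rep[OF Quotient3_poset_algebra]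
            Quotient3_abs_rep[OF Quotient3_free_ba] inv)
    qed
    fix U :: "'p set" assume U: "upset U"
    show "ba_hom (\<lambda>b. upset_eval U (inv h b))"
      using ba_hom_upset_eval[OF U] by (simp add: ba_hom_def inv_hom)
    show "upset_eval U (inv h (h (abs_poset_algebra (abs_free_ba t)))) \<longleftrightarrow>
        bterm_eval (\<lambda>p. p \<in> U) t" for t
      by (simp add: inv upset_eval_abs[OF U] free_eval.abs_eq)
  qed
qed

lemma ba_hom_eq_on_generators:
  fixes d e :: "'b::boolean_algebra \<Rightarrow> 'c::boolean_algebra"
  assumes "ba_generates G" "ba_hom d" "ba_hom e" "\<And>g. g \<in> G \<Longrightarrow> d g = e g"
  shows "d = e"
proof -
  have "ba_subalgebra {b. d b = e b}"
    using assms(2,3) by (auto simp: ba_subalgebra_def ba_hom_def)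
  then have "ba_subalgebra hull G \<subseteq> {b. d b = e b}"
    by (intro hull_minimal) (use assms(4) in auto)
  then show ?thesis using assms(1) by (auto simp: ba_generates_def)
qed

section \<open>The closing-off argument\<close>

text \<open>One witness from V for each q in S that has one suffices. With S the support of an
  element, this is the continuity that passes from finite sets to arbitrary ones.\<close>

lemma finite_approx:
  assumes "finite S"
  shows "\<exists>F. finite F \<and> F \<subseteq> V \<and> (\<forall>q\<in>S. (\<exists>a\<in>F. R a q) \<longleftrightarrow> (\<exists>a\<in>V. R a q))"
proof -
  define f where "f q = (SOME a. a \<in> V \<and> R a q)" for q
  have f: "f q \<in> V \<and> R (f q) q" if "\<exists>a\<in>V. R a q" for q
    using someI_ex[of "\<lambda>a. a \<in> V \<and> R a q"] that unfolding f_def by blast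
  show ?thesis
    by (rule exI[of _ "f ` {q\<in>S. \<exists>a\<in>V. R a q}"]) (use assms f in auto)
qed

abbreviation up_closure :: "'p::order set \<Rightarrow> 'p set" where
  "up_closure X \<equiv> {q. \<exists>a\<in>X. a \<le> q}"

abbreviation down_avoiding :: "'p::order set \<Rightarrow> 'p set" where
  "down_avoiding X \<equiv> {q. \<not> (\<exists>a\<in>X. q \<le> a)}"

lemma upset_up_closure: "upset (up_closure X)"
  and upset_down_avoiding: "upset (down_avoiding X)"
  by (auto simp: upset_def intro: order_trans)

lemma generating_set_large_at_ultrafilter:
  fixes \<kappa> :: "'k rel" and G :: "'b::boolean_algebra set"
  assumes poset: "poset_boolean_algebra TYPE('p::order) TYPE('b)"
    and \<kappa>: "regular_uncountable \<kappa>" and large: "\<kappa> \<le>o |UNIV :: 'b set|"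
    and G: "ba_generates G"
  shows "\<exists>p. ba_ultrafilter p \<and> \<kappa> \<le>o |G \<inter> p|"
proof (rule ccontr)
  assume neg: "\<nexists>p. ba_ultrafilter p \<and> \<kappa> \<le>o |G \<inter> p|"
  have wo: "Well_order \<kappa>"
    using \<kappa> unfolding regular_uncountable_def by (elim conjE) (rule card_order_on_well_order_on)
  obtain i :: "'p bterm \<Rightarrow> 'b" and e :: "'p set \<Rightarrow> 'b \<Rightarrow> bool" where
    i: "surj i" and hom: "\<And>U. upset U \<Longrightarrow> ba_hom (e U)" and
    ev: "\<And>U t. upset U \<Longrightarrow> e U (i t) \<longleftrightarrow> bterm_eval (\<lambda>p. p \<in> U) t"
    using poset_boolean_algebra_terms[OF poset] by auto
  have small: "|{g\<in>G. e U g}| <o \<kappa>" if "upset U" for U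
  proof -
    have "\<not> \<kappa> \<le>o |G \<inter> {b. e U b}|"
      using neg ba_ultrafilter_hom[OF hom[OF that]] by blast
    then have "|G \<inter> {b. e U b}| <o \<kappa>"
      using not_ordLeq_iff_ordLess[OF card_of_Well_order wo] by blast
    then show ?thesis by (simp add: Int_def)
  qed
  \<comment> \<open>The support of b: the variables of one chosen term for it. The value of b at an
    up-set U depends only on the part of U inside \<open>s b\<close>.\<close>
  define s where "s b = set_bterm (inv i b)" for b
  have fin_s: "finite (s b)" for b by (simp add: s_def finite_set_bterm)
  have e_cong: "e U b \<longleftrightarrow> e W b"
    if "upset U" "upset W" "\<And>p. p \<in> s b \<Longrightarrow> p \<in> U \<longleftrightarrow> p \<in> W" for U W b
    using bterm_eval_cong_set[of "inv i b" "\<lambda>p. p \<in> U" "\<lambda>p. p \<in> W"] that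
      ev[of U "inv i b"] ev[of W "inv i b"] by (simp add: s_def surj_f_inv_f[OF i])

  define K where "K X = {g\<in>G. e (up_closure X) g} \<union> {g\<in>G. e (down_avoiding X) g}" for X
  \<comment> \<open>Singletons stand for elements of \<open>P\<close>, so that the closing-off yields both \<open>A\<close> and its
    finite subsets.\<close>
  define D where "D X Y = {X \<union> Y} \<union> (\<lambda>p. {p}) ` (\<Union>g\<in>K X. s g)" for X Y
  have "|K X| <o \<kappa>" for X
    unfolding K_def
    by (intro regular_uncountable_Un[OF \<kappa>] small upset_up_closure upset_down_avoiding)
  then have "|\<Union>g\<in>K X. s g| <o \<kappa>" for X
    by (rule regular_uncountable_UNION[OF \<kappa>]) (rule regular_uncountable_finite[OF \<kappa> fin_s])
  then have "|D X Y| <o \<kappa>" for X Y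
    unfolding D_def
    by (intro regular_uncountable_Un[OF \<kappa>] card_of_image_ordLess
        regular_uncountable_finite[OF \<kappa>, of "{_}"]) simp_all
  moreover have "|{{} :: 'p set}| <o \<kappa>"
    by (intro regular_uncountable_finite[OF \<kappa>]) simp
  ultimately obtain C where C: "{} \<in> C" "|C| <o \<kappa>" "\<And>X Y. X \<in> C \<Longrightarrow> Y \<in> C \<Longrightarrow> D X Y \<subseteq> C"
    using binary_closure_ordLess[OF \<kappa>, of "{{}}" D] by (metis insert_subset)
  define A where "A = {p. {p} \<in> C}"
  have "|A| \<le>o |C|"
    by (rule card_of_ordLeqI[of "\<lambda>p. {p}"]) (auto simp: A_def inj_on_def)
  then have "|A| <o \<kappa>" by (rule ordLeq_ordLess_trans[OF _ C(2)])
  \<comment> \<open>The union component of \<open>D\<close> assembles F from its singletons inside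
    C; then \<open>D F F\<close> contains the singletons of all points of
    \<open>s g\<close>.\<close>
  have supp: "s g \<subseteq> A" if "finite F" "F \<subseteq> A" "g \<in> K F" for F g
  proof -
    have "F \<in> C"
      using that(1,2)
    proof (induction F)
      case (insert x F)
      then have "D {x} F \<subseteq> C" by (intro C(3)) (auto simp: A_def)
      then show ?case by (simp add: D_def)
    qed (use C(1) in simp)
    then have "D F F \<subseteq> C" by (rule C(3)) fact
    then show ?thesis using that(3) by (auto simp: D_def A_def)
  qed
  have supp_up: "s g \<subseteq> A" if "V \<subseteq> A" "g \<in> G" "e (up_closure V) g" for V g
  proof -
    obtain F where F: "finite F" "F \<subseteq> V"
      "\<forall>q\<in>s g. (\<exists>a\<in>F. a \<le> q) \<longleftrightarrow> (\<exists>a\<in>V. a \<le> q)"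
      using finite_approx[OF fin_s[of g], of V "\<lambda>a q. a \<le> q"]
      by (elim exE conjE) (rule that)
    \<comment> \<open>Both up-sets agree on the support of g, so g already belongs to
      \<open>K F\<close> for a finite F.\<close>
    have "e (up_closure F) g \<longleftrightarrow> e (up_closure V) g"
      by (rule e_cong[OF upset_up_closure upset_up_closure]) (use F(3) in blast)
    with that(3) have "e (up_closure F) g" by blast
    then show ?thesis using supp[of F g] F that by (auto simp: K_def)
  qed
  have supp_down: "s g \<subseteq> A" if "V \<subseteq> A" "g \<in> G" "e (down_avoiding V) g" for V g
  proof -
    obtain F where F: "finite F" "F \<subseteq> V"
      "\<forall>q\<in>s g. (\<exists>a\<in>F. q \<le> a) \<longleftrightarrow> (\<exists>a\<in>V. q \<le> a)"
      using finite_approx[OF fin_s[of g], of V "\<lambda>a q. q \<le> a"]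
      by (elim exE conjE) (rule that)
    have "e (down_avoiding F) g \<longleftrightarrow> e (down_avoiding V) g"
      by (rule e_cong[OF upset_down_avoiding upset_down_avoiding]) (use F(3) in blast)
    with that(3) have "e (down_avoiding F) g" by blast
    then show ?thesis using supp[of F g] F that by (auto simp: K_def)
  qed

  \<comment> \<open>Otherwise there would be fewer than \<kappa> terms, hence fewer than \<kappa>
    elements of the algebra.\<close>
  have "A \<noteq> UNIV"
  proof
    assume "A = UNIV"
    then have "|range i| <o \<kappa>"
      using \<open>|A| <o \<kappa>\<close> by (intro card_of_image_ordLess card_of_bterm_ordLess[OF \<kappa>]) simp
    then show False using large i by (auto dest: not_ordLess_ordLeq)
  qed
  then obtain p where p: "p \<notin> A" by blast
  define V where "V = {a\<in>A. p \<le> a}"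
  let ?L = "up_closure V" and ?R = "down_avoiding (A - V)"
  \<comment> \<open>V is upward closed within A, so both up-sets meet A exactly in V.\<close>
  have trace: "q \<in> ?L \<longleftrightarrow> q \<in> ?R" if "q \<in> A" for q
    using that by (auto simp: V_def intro: order_trans)
  \<comment> \<open>If g holds at either up-set, its support lies in A and the common trace decides;
    otherwise g fails at both.\<close>
  have "e ?L g \<longleftrightarrow> e ?R g" if "g \<in> G" for g
  proof -
    have "e ?L g \<longleftrightarrow> e ?R g" if "s g \<subseteq> A"
      using that trace by (intro e_cong upset_up_closure upset_down_avoiding) blast
    moreover have "s g \<subseteq> A" if "e ?L g \<or> e ?R g"
      using that supp_up[OF _ \<open>g \<in> G\<close>, of V] supp_down[OF _ \<open>g \<in> G\<close>, of "A - V"]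
      by (auto simp: V_def)
    ultimately show ?thesis by blast
  qed
  then have "e ?L = e ?R"
    by (intro ba_hom_eq_on_generators[OF G] hom upset_up_closure upset_down_avoiding)
  then have "p \<in> ?L \<longleftrightarrow> p \<in> ?R"
    using ev[OF upset_up_closure, of V "BVar p"] ev[OF upset_down_avoiding, of "A - V" "BVar p"]
    by simp
  \<comment> \<open>Membership would give a in A with p \<le> a \<le> p, so p = a would lie in A. On
    the other side, any a in A above p belongs to V by definition.\<close>
  moreover have "p \<notin> ?L"
    using p by (auto simp: V_def dest: order_antisym)
  moreover have "p \<in> ?R" by (auto simp: V_def)
  ultimately show False by blast
qed

lemma not_corsonI:
  assumes "\<And>G :: 'b::boolean_algebra set. ba_generates G \<Longrightarrow> \<exists>p. ba_ultrafilter p \<and> \<kappa> \<le>o |G \<inter> p|"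
  shows "\<not> corson \<kappa> TYPE('b)"
proof
  assume "corson \<kappa> TYPE('b)"
  then obtain G :: "'b set" where G: "ba_generates G" "\<And>p. ba_ultrafilter p \<Longrightarrow> |G \<inter> p| <o \<kappa>"
    by (auto simp: corson_def)
  with assms obtain p where "ba_ultrafilter p" "\<kappa> \<le>o |G \<inter> p|" by blast
  with not_ordLess_ordLeq[OF G(2)] show False by blast
qed

theorem theorem4p11:
  assumes "poset_boolean_algebra TYPE('p::order) TYPE('b::boolean_algebra)"
  shows "(\<forall>\<kappa> :: 'k rel. regular_uncountable \<kappa> \<and> \<kappa> \<le>o |UNIV :: 'b set| \<longrightarrow>
            (\<forall>G :: 'b set. ba_generates G \<longrightarrow> (\<exists>p. ba_ultrafilter p \<and> \<kappa> \<le>o |G \<inter> p| )) \<and>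
            \<not> corson \<kappa> TYPE('b)) \<and>
         (regular_uncountable |UNIV :: 'b set| \<longrightarrow>
            (\<forall>G :: 'b set. ba_generates G \<longrightarrow>
               (\<exists>p. ba_ultrafilter p \<and> |G \<inter> p| =o |UNIV :: 'b set| )) \<and>
            \<not> corson |UNIV :: 'b set| TYPE('b))"
proof (intro conjI allI impI; (elim conjE)?)
  fix \<kappa> :: "'k rel" and G :: "'b set"
  assume \<kappa>: "regular_uncountable \<kappa>" "\<kappa> \<le>o |UNIV :: 'b set|"
  show "\<exists>p. ba_ultrafilter p \<and> \<kappa> \<le>o |G \<inter> p|" if "ba_generates G"
    by (rule generating_set_large_at_ultrafilter[OF assms \<kappa> that])
  show "\<not> corson \<kappa> TYPE('b)"
    by (rule not_corsonI) (rule generating_set_large_at_ultrafilter[OF assms \<kappa>])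
next
  assume \<kappa>: "regular_uncountable |UNIV :: 'b set|"
  \<comment> \<open>The cardinal is now a relation on \<open>'b\<close> instead of
    \<open>'k\<close>, so the general lemma is applied again rather than the first half of the
    theorem.\<close>
  have *: "\<exists>p. ba_ultrafilter p \<and> |UNIV :: 'b set| \<le>o |G \<inter> p|" if "ba_generates G" for G :: "'b set"
    by (rule generating_set_large_at_ultrafilter[OF assms \<kappa> _ that]) (rule card_of_mono1[OF subset_UNIV])
  show "\<exists>p. ba_ultrafilter p \<and> |G \<inter> p| =o |UNIV :: 'b set|" if "ba_generates G" for G :: "'b set"
    using *[OF that] card_of_mono1[OF subset_UNIV] by (auto simp: ordIso_iff_ordLeq)
  show "\<not> corson |UNIV :: 'b set| TYPE('b)"
    by (rule not_corsonI) (rule *)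
qed

end
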